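(* Let $T$ be a tree with $m$ edges and let $k\geq 2$. Set $q=(4k(km+1)(k^2-k+1))^{\frac{1}{k-1}}$. Then for all sufficiently large $n$, $$f_k(n,T)\geq n^{\frac{k}{k-1}}/q.$$
   Context: All colourings are edge-colourings of the complete graph $K_n$; a colouring is proper if any two edges sharing a vertex receive different colours. Two copies of a graph $H$ in an edge-coloured $K_n$ are colour isomorphic if there is a graph isomorphism between them mapping each edge to an edge of the same colour. A $k$-repeat of $H$ is a collection of $k$ pairwise vertex-disjoint, pairwise colour-isomorphic copies of $H$. For integers $k,n\geq 2$ and a graph $H$, $f_k(n,H)$ is the smallest integer $C$ such that there is a proper edge-colouring of $K_n$ with $C$ colours containing no $k$-repeat of $H$. *)

theory Defs
  imports Complex_Main "HOL-Library.Ramsey" "HOL-Library.Extended_Real"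
begin

(* Edges are two-element vertex sets; nsets A 2 from HOL-Library.Ramsey is the set of
   all two-element subsets of A. *)
record 'a ugraph =
  verts :: "'a set"
  edges :: "'a set set"

definition simple_graph :: "'a ugraph \<Rightarrow> bool" where
  "simple_graph G \<longleftrightarrow> finite (verts G) \<and> edges G \<subseteq> nsets (verts G) 2"

definition connected_graph :: "'a ugraph \<Rightarrow> bool" where
  "connected_graph G \<longleftrightarrow> verts G \<noteq> {} \<and>
     (\<forall>u\<in>verts G. \<forall>v\<in>verts G. (u, v) \<in> {(x, y). {x, y} \<in> edges G}\<^sup>*)"

(* The closing edge joins the last vertex of the list to the first one. *)
definition graph_cycle :: "'a ugraph \<Rightarrow> 'a list \<Rightarrow> bool" where
  "graph_cycle G xs \<longleftrightarrow> 3 \<le> length xs \<and> distinct xs \<and> set xs \<subseteq> verts G \<and>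
     (\<forall>i<length xs. {xs ! i, xs ! (Suc i mod length xs)} \<in> edges G)"

definition tree :: "'a ugraph \<Rightarrow> bool" where
  "tree G \<longleftrightarrow> simple_graph G \<and> connected_graph G \<and> (\<nexists>xs. graph_cycle G xs)"

definition graph_iso :: "('a \<Rightarrow> 'b) \<Rightarrow> 'a ugraph \<Rightarrow> 'b ugraph \<Rightarrow> bool" where
  "graph_iso \<phi> G H \<longleftrightarrow> bij_betw \<phi> (verts G) (verts H) \<and>
     (\<forall>u\<in>verts G. \<forall>v\<in>verts G. {u, v} \<in> edges G \<longleftrightarrow> {\<phi> u, \<phi> v} \<in> edges H)"

definition complete_graph :: "nat \<Rightarrow> nat ugraph" where
  "complete_graph n = \<lparr>verts = {..<n}, edges = nsets {..<n} 2\<rparr>"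

(* A copy of H in G is a (not necessarily induced) subgraph of G isomorphic to H. *)
definition copy_in :: "'a ugraph \<Rightarrow> 'b ugraph \<Rightarrow> 'a ugraph \<Rightarrow> bool" where
  "copy_in G H F \<longleftrightarrow> simple_graph F \<and> verts F \<subseteq> verts G \<and> edges F \<subseteq> edges G \<and>
     (\<exists>\<phi>. graph_iso \<phi> H F)"

definition proper_colouring :: "'a ugraph \<Rightarrow> ('a set \<Rightarrow> 'c) \<Rightarrow> bool" where
  "proper_colouring G c \<longleftrightarrow>
     (\<forall>e\<in>edges G. \<forall>e'\<in>edges G. e \<noteq> e' \<and> e \<inter> e' \<noteq> {} \<longrightarrow> c e \<noteq> c e')"

definition colour_isomorphic :: "('a set \<Rightarrow> 'c) \<Rightarrow> 'a ugraph \<Rightarrow> 'a ugraph \<Rightarrow> bool" where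
  "colour_isomorphic c F F' \<longleftrightarrow>
     (\<exists>\<phi>. graph_iso \<phi> F F' \<and> (\<forall>e\<in>edges F. c (\<phi> ` e) = c e))"

definition is_repeat ::
    "'a ugraph \<Rightarrow> ('a set \<Rightarrow> 'c) \<Rightarrow> nat \<Rightarrow> 'b ugraph \<Rightarrow> 'a ugraph set \<Rightarrow> bool" where
  "is_repeat G c k H S \<longleftrightarrow> finite S \<and> card S = k \<and> (\<forall>F\<in>S. copy_in G H F) \<and>
     pairwise (\<lambda>F F'. disjnt (verts F) (verts F')) S \<and> pairwise (colour_isomorphic c) S"

definition repeat_free_colour_counts :: "nat \<Rightarrow> nat \<Rightarrow> 'b ugraph \<Rightarrow> nat set" where
  "repeat_free_colour_counts k n H =
     {C. \<exists>c :: nat set \<Rightarrow> nat. proper_colouring (complete_graph n) c \<and>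
           card (c ` edges (complete_graph n)) = C \<and>
           (\<nexists>S. is_repeat (complete_graph n) c k H S)}"

(* Taken in enat so that the minimum is infinity, rather than an arbitrary number, when
   no colouring avoids k-repeats. For k >= 2 that happens only if H is edgeless: see the
   two lemmas below. *)
definition repeat_number :: "nat \<Rightarrow> nat \<Rightarrow> 'b ugraph \<Rightarrow> enat" where
  "repeat_number k n H = Inf (enat ` repeat_free_colour_counts k n H)"

lemma repeat_number_eq_Least:
  assumes "repeat_free_colour_counts k n H \<noteq> {}"
  shows "repeat_number k n H = enat (LEAST C. C \<in> repeat_free_colour_counts k n H)"
proof (rule antisym)
  let ?A = "repeat_free_colour_counts k n H"
  have "(LEAST C. C \<in> ?A) \<in> ?A"
    using assms LeastI_ex[of "\<lambda>C. C \<in> ?A"] by blast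
  then show "repeat_number k n H \<le> enat (LEAST C. C \<in> ?A)"
    unfolding repeat_number_def by (intro Inf_lower imageI)
  have "enat (LEAST C. C \<in> ?A) \<le> enat C" if "C \<in> ?A" for C
    using that Least_le[of "\<lambda>C. C \<in> ?A" C] by simp
  then show "enat (LEAST C. C \<in> ?A) \<le> repeat_number k n H"
    unfolding repeat_number_def by (intro Inf_greatest) blast
qed

lemma repeat_free_colour_counts_nonempty:
  assumes H: "simple_graph H" "edges H \<noteq> {}" and k: "2 \<le> k"
  shows "repeat_free_colour_counts k n H \<noteq> {}"
proof -
  let ?K = "complete_graph n"
  have "finite (edges ?K)"
    unfolding complete_graph_def by (simp, rule finite_imp_finite_nsets) simp
  from finite_imp_inj_to_nat_seg[OF this]
  obtain c :: "nat set \<Rightarrow> nat" where c: "inj_on c (edges ?K)"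
    by blast
  then have "proper_colouring ?K c"
    by (auto simp: proper_colouring_def inj_on_eq_iff[OF c])
  moreover have "\<nexists>S. is_repeat ?K c k H S"
  proof
    assume "\<exists>S. is_repeat ?K c k H S"
    then obtain S where S: "is_repeat ?K c k H S" ..
    then have "\<not> card S \<le> 1" "finite S"
      using k by (auto simp: is_repeat_def)
    then obtain F F' where FS: "F \<in> S" "F' \<in> S" "F \<noteq> F'"
      using card_le_Suc0_iff_eq[of S] by auto
    have F: "copy_in ?K H F" "copy_in ?K H F'"
      using S FS(1,2) by (simp_all add: is_repeat_def)
    have disj: "disjnt (verts F) (verts F')" and "colour_isomorphic c F F'"
      using S FS by (simp_all add: is_repeat_def pairwise_def)
    then obtain \<phi> where \<phi>: "graph_iso \<phi> F F'" "\<forall>e\<in>edges F. c (\<phi> ` e) = c e"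
      by (auto simp: colour_isomorphic_def)
    obtain \<psi> where \<psi>: "graph_iso \<psi> H F"
      using F(1) unfolding copy_in_def by blast
    obtain e where "e \<in> edges H"
      using H(2) by blast
    then obtain x y where xy: "{x, y} \<in> edges H" "x \<in> verts H" "y \<in> verts H"
      using H(1) unfolding simple_graph_def nsets_def by (auto simp: card_2_iff)
    define u v where "u = \<psi> x" and "v = \<psi> y"
    have uv: "{u, v} \<in> edges F" "u \<in> verts F" "v \<in> verts F"
      using \<psi> xy by (auto simp: graph_iso_def u_def v_def bij_betwE)
    then have uv': "{\<phi> u, \<phi> v} \<in> edges F'" "\<phi> u \<in> verts F'"
      using \<phi>(1) by (auto simp: graph_iso_def bij_betwE)
    have "c {\<phi> u, \<phi> v} = c {u, v}"
      using bspec[OF \<phi>(2) uv(1)] by simp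
    moreover have "{u, v} \<in> edges ?K" "{\<phi> u, \<phi> v} \<in> edges ?K"
      using F uv(1) uv'(1) by (auto simp: copy_in_def)
    ultimately have "{\<phi> u, \<phi> v} = {u, v}"
      by (simp add: inj_on_eq_iff[OF c])
    then have "\<phi> u \<in> verts F"
      using uv(2,3) by (auto simp: doubleton_eq_iff)
    then show False
      using disj uv'(2) by (auto simp: disjnt_def)
  qed
  ultimately show ?thesis
    unfolding repeat_free_colour_counts_def by blast
qed

end

theory Submission
  imports Defs
begin

text \<open>Consider the auxiliary graph on \<open>k\<close>-tuples of vertices of \<open>K\<^sub>n\<close> in which two tuples are
  adjacent when the \<open>k\<close> edges joining corresponding entries are distinct and have a common
  colour; a copy of \<open>T\<close> in it whose tuples are pairwise disjoint is a \<open>k\<close>-repeat of \<open>T\<close>. If there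
  are few colours, convexity of \<open>x\<^sup>k\<close> gives many edges, hence a subgraph of minimum degree
  greater than \<open>k\<^sup>2 m\<close>. In a proper colouring a neighbour of a tuple is determined by any one of
  its entries, so at most \<open>k \<cdot> k m\<close> neighbours meet the entries already used, and \<open>T\<close> can be
  embedded greedily.\<close>

section \<open>Passing from large average degree to large minimum degree\<close>

text \<open>Delete vertices with at most \<open>d\<close> neighbours one at a time. By symmetry such
  a vertex lies in at most \<open>2 * d\<close> ordered pairs of \<open>E\<close>, so the strict
  density hypothesis survives each deletion. As it fails for the empty set, the deletions stop at a
  nonempty \<open>U\<close>.\<close>

lemma min_degree_subset:
  fixes E :: "('a \<times> 'a) set"
  assumes "finite V" "sym E" "E \<subseteq> V \<times> V" "card E > 2 * d * card V"
  shows "\<exists>U\<subseteq>V. U \<noteq> {} \<and> (\<forall>u\<in>U. card {w\<in>U. (u, w) \<in> E} > d)"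
  using assms
proof (induction "card V" arbitrary: V E)
  case 0
  then show ?case by simp
next
  case (Suc j)
  show ?case
  proof (cases "\<forall>u\<in>V. card {w\<in>V. (u, w) \<in> E} > d")
    case True
    have "V \<noteq> {}" using Suc.hyps(2) by auto
    with True show ?thesis by blast
  next
    case False
    then obtain u where u: "u \<in> V" "card {w\<in>V. (u, w) \<in> E} \<le> d"
      by (auto simp: not_less)
    let ?N = "{w\<in>V. (u, w) \<in> E}"
    define E' where "E' = E \<inter> (V - {u}) \<times> (V - {u})"
    have finN: "finite ?N" using Suc.prems(1) by simp
    have finE': "finite E'" using Suc.prems(1) unfolding E'_def by blast
    have "E \<subseteq> E' \<union> (Pair u ` ?N \<union> (\<lambda>w. (w, u)) ` ?N)"
      using Suc.prems(2,3) unfolding E'_def sym_def by auto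
    then have "card E \<le> card (E' \<union> (Pair u ` ?N \<union> (\<lambda>w. (w, u)) ` ?N))"
      using finN finE' by (intro card_mono) auto
    also have "\<dots> \<le> card E' + (card (Pair u ` ?N) + card ((\<lambda>w. (w, u)) ` ?N))"
      by (meson add_le_mono card_Un_le le_trans order_refl)
    also have "\<dots> \<le> card E' + (card ?N + card ?N)"
      by (intro add_mono card_image_le finN order_refl)
    finally have "card E \<le> card E' + 2 * d" using u(2) by linarith
    moreover have V': "card (V - {u}) = j" using u(1) Suc.hyps(2) Suc.prems(1) by simp
    ultimately have "card E' > 2 * d * card (V - {u})"
      using Suc.prems(4) Suc.hyps(2)[symmetric] by (simp add: algebra_simps)
    moreover have "sym E'" using Suc.prems(2) unfolding E'_def sym_def by auto
    moreover have "E' \<subseteq> (V - {u}) \<times> (V - {u})" unfolding E'_def by blast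
    ultimately obtain U where U: "U \<subseteq> V - {u}" "U \<noteq> {}"
        "\<forall>v\<in>U. card {w\<in>U. (v, w) \<in> E'} > d"
      using Suc.hyps(1)[of "V - {u}" E'] V' Suc.prems(1) by auto
    have "{w\<in>U. (v, w) \<in> E'} = {w\<in>U. (v, w) \<in> E}" if "v \<in> U" for v
      using U(1) that unfolding E'_def by auto
    with U show ?thesis by (intro exI[of _ U]) auto
  qed
qed

section \<open>Greedy embedding of trees\<close>

text \<open>Otherwise, by induction along a walk from \<open>s0\<close>, every vertex reached would
  stay in \<open>W\<close>, including \<open>t0\<close>.\<close>

lemma connected_leaves_proper_subset:
  assumes "connected_graph G" "s0 \<in> W" "W \<subseteq> verts G" "t0 \<in> verts G" "t0 \<notin> W"
  shows "\<exists>s\<in>W. \<exists>t. t \<notin> W \<and> {s, t} \<in> edges G"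
proof (rule ccontr)
  assume contra: "\<not> ?thesis"
  have "(s0, t0) \<in> {(x, y). {x, y} \<in> edges G}\<^sup>*"
    using assms unfolding connected_graph_def by blast
  then have "t0 \<in> W"
    by (induction rule: rtrancl_induct) (use assms(2) contra in blast)+
  with assms(5) show False ..
qed

lemma graph_cycle_of_path:
  assumes "set xs \<subseteq> verts G" "distinct xs" "successively (\<lambda>x y. {x, y} \<in> edges G) xs"
    and "2 \<le> length xs" "t \<in> verts G" "t \<notin> set xs"
    and "{t, hd xs} \<in> edges G" "{last xs, t} \<in> edges G"
  shows "graph_cycle G (t # xs)"
proof -
  have ne: "xs \<noteq> []" using assms(4) by auto
  have "{(t # xs) ! i, (t # xs) ! (Suc i mod length (t # xs))} \<in> edges G"
    if i: "i < length (t # xs)" for i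
  \<comment> \<open>Only the last position of \<open>t # xs\<close> has a successor that wraps
    around, back to \<open>t\<close>.\<close>
  proof (cases "i = length xs")
    case True
    then have "(t # xs) ! i = last xs" using ne by (simp add: last_conv_nth nth_Cons')
    then show ?thesis using True assms(8) by simp
  next
    case False
    then have i': "i < length xs" using i by simp
    then have "Suc i mod length (t # xs) = Suc i" by simp
    moreover have "{(t # xs) ! i, xs ! i} \<in> edges G"
    proof (cases i)
      case 0
      then show ?thesis using assms(7) ne by (simp add: hd_conv_nth)
    next
      case (Suc j)
      then show ?thesis using assms(3) i' by (auto simp: successively_conv_nth)
    qed
    ultimately show ?thesis by simp
  qed
  then show ?thesis using assms unfolding graph_cycle_def by simp
qed

text \<open>The vertices are placed one at a time, each along an edge leaving the part already
  placed; \<open>ext\<close> supplies an image for the new vertex that is \<open>P\<close>-related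
  to all earlier images. Later \<open>R\<close> is adjacency of tuples and \<open>P\<close> says
  that two tuples share no entry.\<close>

lemma greedy_tree_embedding:
  fixes T :: "'a ugraph"
  assumes T: "tree T" and "sym R" and symP: "symp P" and u0: "u0 \<in> U"
    and ext: "\<And>v A. v \<in> U \<Longrightarrow> A \<subseteq> U \<Longrightarrow> finite A \<Longrightarrow> card A \<le> card (edges T) \<Longrightarrow>
                \<exists>w\<in>U. (v, w) \<in> R \<and> (\<forall>a\<in>A. P a w)"
  shows "\<exists>\<phi>. \<phi> ` verts T \<subseteq> U \<and> (\<forall>s t. {s, t} \<in> edges T \<longrightarrow> (\<phi> s, \<phi> t) \<in> R) \<and>
           (\<forall>s\<in>verts T. \<forall>t\<in>verts T. s \<noteq> t \<longrightarrow> P (\<phi> s) (\<phi> t))"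
proof -
  let ?V = "verts T" and ?E = "edges T"
  have finV: "finite ?V" and EV: "?E \<subseteq> nsets ?V 2" and conn: "connected_graph T"
    and acyc: "\<nexists>xs. graph_cycle T xs"
    using T unfolding tree_def simple_graph_def by auto
  have finE: "finite ?E" using EV finV finite_imp_finite_nsets finite_subset by blast
  have edgeD: "s \<in> ?V" "t \<in> ?V" "s \<noteq> t" if "{s, t} \<in> ?E" for s t
    using EV that by (auto simp: nsets_def card_2_iff doubleton_eq_iff)
  \<comment> \<open>Connectedness of the part placed so far rules out a second neighbour of the new vertex (it
    would close a cycle); the last clause bounds the number of vertices placed by the number
    of edges.\<close>
  define inv where "inv = (\<lambda>W (\<phi>::'a \<Rightarrow> 'b). W \<subseteq> ?V \<and> W \<noteq> {} \<and> \<phi> ` W \<subseteq> U \<and>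
     (\<forall>s\<in>W. \<forall>t\<in>W. {s, t} \<in> ?E \<longrightarrow> (\<phi> s, \<phi> t) \<in> R) \<and>
     (\<forall>s\<in>W. \<forall>t\<in>W. s \<noteq> t \<longrightarrow> P (\<phi> s) (\<phi> t)) \<and>
     (\<forall>s\<in>W. \<forall>t\<in>W. \<exists>xs. xs \<noteq> [] \<and> hd xs = s \<and> last xs = t \<and> set xs \<subseteq> W \<and> distinct xs \<and>
         successively (\<lambda>x y. {x, y} \<in> ?E) xs) \<and>
     card W \<le> Suc (card {e\<in>?E. e \<subseteq> W}))"
  have step: "\<exists>t \<psi>. t \<notin> W \<and> inv (insert t W) \<psi>" if I: "inv W \<phi>" and NV: "W \<noteq> ?V" for W \<phi>
  proof -
    have W: "W \<subseteq> ?V" "W \<noteq> {}" "\<phi> ` W \<subseteq> U"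
      and WR: "\<And>s t. s \<in> W \<Longrightarrow> t \<in> W \<Longrightarrow> {s, t} \<in> ?E \<Longrightarrow> (\<phi> s, \<phi> t) \<in> R"
      and WP: "\<And>s t. s \<in> W \<Longrightarrow> t \<in> W \<Longrightarrow> s \<noteq> t \<Longrightarrow> P (\<phi> s) (\<phi> t)"
      and Wc: "\<And>s t. s \<in> W \<Longrightarrow> t \<in> W \<Longrightarrow> \<exists>xs. xs \<noteq> [] \<and> hd xs = s \<and> last xs = t \<and>
           set xs \<subseteq> W \<and> distinct xs \<and> successively (\<lambda>x y. {x, y} \<in> ?E) xs"
      and Wk: "card W \<le> Suc (card {e\<in>?E. e \<subseteq> W})"
      using I unfolding inv_def by simp_all
    have finW: "finite W" using W(1) finV finite_subset by blast
    obtain s t where st: "s \<in> W" "t \<notin> W" "{s, t} \<in> ?E"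
      using connected_leaves_proper_subset[OF conn _ W(1)] W(1,2) NV by blast
    have tV: "t \<in> ?V" using edgeD st(3) by blast
    have uniq: "s' = s" if "s' \<in> W" "{s', t} \<in> ?E" for s'
    proof (rule ccontr)
      assume "s' \<noteq> s"
      obtain xs where xs: "xs \<noteq> []" "hd xs = s" "last xs = s'" "set xs \<subseteq> W" "distinct xs"
          "successively (\<lambda>x y. {x, y} \<in> ?E) xs"
        using Wc[OF st(1) \<open>s' \<in> W\<close>] by blast
      have "2 \<le> length xs"
        using xs(1,2,3) \<open>s' \<noteq> s\<close> by (cases xs; cases "tl xs") auto
      then have "graph_cycle T (t # xs)"
        using xs st W(1) tV that(2)
        by (intro graph_cycle_of_path) (auto simp: insert_commute)
      with acyc show False by blast
    qed
    \<comment> \<open>The edge \<open>{s, t}\<close> does not lie inside \<open>W\<close>, so the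
      edge count grows along with the vertex count. Hence at most \<open>card (edges T)\<close>
      vertices are placed before \<open>t\<close>, which is the size that \<open>ext\<close>
      allows.\<close>
    have eW: "{e\<in>?E. e \<subseteq> W} \<union> {{s, t}} \<subseteq> {e\<in>?E. e \<subseteq> insert t W}"
      using st by auto
    have "card ({e\<in>?E. e \<subseteq> W} \<union> {{s, t}}) = Suc (card {e\<in>?E. e \<subseteq> W})"
      using finE st(2) by simp
    then have cardE: "Suc (card {e\<in>?E. e \<subseteq> W}) \<le> card {e\<in>?E. e \<subseteq> insert t W}"
      using card_mono[OF _ eW] finE by simp
    have "card {e\<in>?E. e \<subseteq> insert t W} \<le> card ?E"
      using finE by (intro card_mono) auto
    then have "card (\<phi> ` W) \<le> card ?E"
      using card_image_le[OF finW, of \<phi>] Wk cardE by linarith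
    then obtain w where w: "w \<in> U" "(\<phi> s, w) \<in> R" "\<forall>a\<in>\<phi> ` W. P a w"
      using ext[of "\<phi> s" "\<phi> ` W"] W(3) st(1) finW by blast
    have wR: "(w, \<phi> s) \<in> R" using w(2) \<open>sym R\<close> by (simp add: symD)
    have wP: "P w a" if "a \<in> \<phi> ` W" for a using w(3) that symP by (blast dest: sympD)
    define \<psi> where "\<psi> = \<phi>(t := w)"
    have \<psi>W: "\<psi> x = \<phi> x" if "x \<in> W" for x using that st(2) by (auto simp: \<psi>_def)
    have \<psi>t: "\<psi> t = w" by (simp add: \<psi>_def)
    have paths: "\<exists>xs. xs \<noteq> [] \<and> hd xs = a \<and> last xs = b \<and> set xs \<subseteq> insert t W \<and> distinct xs \<and>
         successively (\<lambda>x y. {x, y} \<in> ?E) xs"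
      if ab: "a \<in> insert t W" "b \<in> insert t W" for a b
    proof -
      consider "a \<in> W" "b \<in> W" | "a = t" "b = t" | "a = t" "b \<in> W" | "a \<in> W" "b = t"
        using ab by blast
      then show ?thesis
      proof cases
        case 1
        then show ?thesis using Wc[of a b] by blast
      next
        case 2
        then show ?thesis by (intro exI[of _ "[t]"]) auto
      next
        case 3
        obtain xs where "xs \<noteq> []" "hd xs = s" "last xs = b" "set xs \<subseteq> W" "distinct xs"
          "successively (\<lambda>x y. {x, y} \<in> ?E) xs"
          using Wc[OF st(1) 3(2)] by blast
        then show ?thesis using 3 st
          by (intro exI[of _ "t # xs"]) (auto simp: successively_Cons insert_commute)
      next
        case 4
        obtain xs where "xs \<noteq> []" "hd xs = a" "last xs = s" "set xs \<subseteq> W" "distinct xs"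
          "successively (\<lambda>x y. {x, y} \<in> ?E) xs"
          using Wc[OF 4(1) st(1)] by blast
        then show ?thesis using 4 st
          by (intro exI[of _ "xs @ [t]"]) (auto simp: successively_append_iff)
      qed
    qed
    have "(\<psi> a, \<psi> b) \<in> R" if ab: "a \<in> insert t W" "b \<in> insert t W" "{a, b} \<in> ?E" for a b
    proof -
      \<comment> \<open>By \<open>uniq\<close> the only edge between \<open>t\<close> and
        \<open>W\<close> is \<open>{s, t}\<close>, and loops are excluded, so the edge used to
        choose \<open>w\<close> is the only new one to check.\<close>
      consider "a \<in> W" "b \<in> W" | "a = t" "b = s" | "a = s" "b = t"
        using ab uniq edgeD(3) by (metis insert_commute insert_iff)
      then show ?thesis
        by cases (simp_all add: WR ab w(2) wR st \<psi>W \<psi>t)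
    qed
    moreover have "P (\<psi> a) (\<psi> b)" if "a \<in> insert t W" "b \<in> insert t W" "a \<noteq> b" for a b
      using that WP w(3) wP \<psi>W \<psi>t by auto
    moreover have "\<psi> ` insert t W \<subseteq> U"
      using W(3) w(1) \<psi>W \<psi>t by auto
    moreover have "card (insert t W) \<le> Suc (card {e\<in>?E. e \<subseteq> insert t W})"
      using finW st(2) Wk cardE by simp
    ultimately have "inv (insert t W) \<psi>"
      unfolding inv_def using W(1) tV paths by simp
    then show ?thesis using st(2) by blast
  qed
  have grow: "\<exists>\<psi>. inv ?V \<psi>" if "inv W \<phi>" for W \<phi>
    using that
  proof (induction "card ?V - card W" arbitrary: W \<phi> rule: less_induct)
    case less
    show ?case
    proof (cases "W = ?V")
      case True
      with less.prems show ?thesis by blast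
    next
      case False
      then obtain t \<psi> where t: "t \<notin> W" "inv (insert t W) \<psi>" using step less.prems by blast
      then have "insert t W \<subseteq> ?V" unfolding inv_def by simp
      then have "card (insert t W) \<le> card ?V" using finV by (intro card_mono)
      moreover have "finite W" using finite_subset[OF \<open>insert t W \<subseteq> ?V\<close> finV] by simp
      ultimately show ?thesis using less.hyps[OF _ t(2)] t(1) by simp
    qed
  qed
  obtain r where r: "r \<in> ?V" using conn unfolding connected_graph_def by blast
  have "\<exists>xs. xs \<noteq> [] \<and> hd xs = r \<and> last xs = r \<and> set xs \<subseteq> {r} \<and> distinct xs \<and>
         successively (\<lambda>x y. {x, y} \<in> ?E) xs"
    by (rule exI[of _ "[r]"]) simp
  then have "inv {r} (\<lambda>_. u0)"
    unfolding inv_def using r u0 edgeD(3)[of r r] by auto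
  then obtain \<psi> where \<psi>: "inv ?V \<psi>" using grow by blast
  have "(\<psi> s, \<psi> t) \<in> R" if "{s, t} \<in> ?E" for s t
    using \<psi> that edgeD[OF that] unfolding inv_def by simp
  with \<psi> show ?thesis unfolding inv_def by (intro exI[of _ \<psi>]) simp
qed

section \<open>Counting lists with distinct images, and numerical estimates\<close>

text \<open>Choose the entries in turn: each earlier entry forbids at most 2 elements, so there are
  at least d(d-2)(d-4)...(d-2(k-1)) lists while the factors are nonnegative, and 2(1+...+(k-1)) =
  k(k-1). Later \<open>f\<close> forgets the orientation of an edge, whence fibres of size at most
  2.\<close>

lemma card_lists_distinct_images:
  fixes f :: "'a \<Rightarrow> 'b"
  assumes fin: "finite D" and fib: "\<And>y. card {x\<in>D. f x = y} \<le> 2"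
  shows "real (card D) ^ k - real k * (real k - 1) * real (card D) ^ (k - 1)
           \<le> real (card {xs. length xs = k \<and> set xs \<subseteq> D \<and> distinct (map f xs)})"
proof (induction k)
  case 0
  have "{xs. length xs = 0 \<and> set xs \<subseteq> D \<and> distinct (map f xs)} = {[]}" by auto
  then show ?case by simp
next
  case (Suc j)
  define L where "L = (\<lambda>k. {xs. length xs = k \<and> set xs \<subseteq> D \<and> distinct (map f xs)})"
  let ?d = "card D"
  have finL: "finite (L k)" for k
    by (rule finite_subset[OF _ finite_lists_length_eq[OF fin, of k]]) (auto simp: L_def)
  define X where "X = (\<lambda>xs. D - {x\<in>D. f x \<in> f ` set xs})"
  have X: "?d \<le> card (X xs) + 2 * j" if "xs \<in> L j" for xs
  proof -
    have "{x\<in>D. f x \<in> f ` set xs} = (\<Union>y\<in>f ` set xs. {x\<in>D. f x = y})" by auto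
    then have "card {x\<in>D. f x \<in> f ` set xs} \<le> (\<Sum>y\<in>f ` set xs. card {x\<in>D. f x = y})"
      using card_UN_le[of "f ` set xs" "\<lambda>y. {x\<in>D. f x = y}"] by simp
    also have "\<dots> \<le> (\<Sum>y\<in>f ` set xs. 2)" by (intro sum_mono fib)
    also have "\<dots> \<le> 2 * j"
    proof -
      have "card (f ` set xs) \<le> card (set xs)" by (simp add: card_image_le)
      also have "\<dots> \<le> j" using that card_length[of xs] by (simp add: L_def)
      finally show ?thesis by simp
    qed
    finally have "card {x\<in>D. f x \<in> f ` set xs} \<le> 2 * j" .
    moreover have "card (X xs) = ?d - card {x\<in>D. f x \<in> f ` set xs}"
      unfolding X_def using fin by (intro card_Diff_subset) auto
    ultimately show ?thesis by linarith
  qed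
  have "L (Suc j) = (\<lambda>(xs, x). x # xs) ` (SIGMA xs:L j. X xs)" (is "_ = ?h ` ?S")
  proof (intro set_eqI iffI)
    fix ys assume "ys \<in> L (Suc j)"
    then show "ys \<in> ?h ` ?S"
      by (cases ys) (force simp: L_def X_def image_iff)+
  qed (auto simp: L_def X_def)
  moreover have "inj_on ?h ?S" by (auto simp: inj_on_def)
  ultimately have cL: "card (L (Suc j)) = (\<Sum>xs\<in>L j. card (X xs))"
    using finL fin by (simp add: card_image card_SigmaI X_def)
  have "real (card (L j)) * (real ?d - 2 * real j) = (\<Sum>xs\<in>L j. real ?d - 2 * real j)" by simp
  also have "\<dots> \<le> (\<Sum>xs\<in>L j. real (card (X xs)))"
    using X by (intro sum_mono) fastforce
  finally have rec: "real (card (L j)) * (real ?d - 2 * real j) \<le> real (card (L (Suc j)))"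
    using cL by simp
  have "real ?d ^ Suc j - (real j + 1) * real j * real ?d ^ j \<le> real (card (L (Suc j)))"
  proof (cases j)
    case 0
    have "L 0 = {[]}" by (auto simp: L_def)
    then show ?thesis using rec 0 by simp
  next
    case (Suc i)
    show ?thesis
    \<comment> \<open>The induction hypothesis may only be multiplied by \<open>?d - 2 * j\<close>
      if this is nonnegative. Then 2j + j(j-1) = (j+1)j gives the new coefficient, and the remaining
      cross term is nonnegative. Otherwise \<open>?d\<close> is below 2j, hence below (j+1)j, and
      the claimed lower bound is not positive.\<close>
    proof (cases "2 * j \<le> ?d")
      case True
      have "real ?d ^ Suc j - (real j + 1) * real j * real ?d ^ j
          \<le> (real ?d ^ j - real j * (real j - 1) * real ?d ^ i) * (real ?d - 2 * real j)"
        using Suc by (simp add: algebra_simps)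
      also have "\<dots> \<le> real (card (L j)) * (real ?d - 2 * real j)"
        using Suc.IH True Suc by (intro mult_right_mono) (auto simp: L_def)
      finally show ?thesis using rec by simp
    next
      case False
      then have "real ?d \<le> 2 * real j" by simp
      also have "\<dots> \<le> (real j + 1) * real j" using Suc by (intro mult_right_mono) auto
      finally have "real ?d ^ j * real ?d \<le> real ?d ^ j * ((real j + 1) * real j)"
        by (intro mult_left_mono) auto
      then show ?thesis by (simp add: mult_ac)
    qed
  qed
  then show ?case by (simp add: L_def add.commute)
qed

lemma square_minus_self_plus_one_ge: "(1::real) \<le> (real k)\<^sup>2 - real k + 1"
  using self_le_power[of k 2] by (cases "k = 0") (simp_all flip: of_nat_power)

text \<open>Trades the lower-order term for a factor 1/K and a constant error, so that the main term
  is a pure power of \<open>card D\<close> to which convexity applies. Since k(k-1) = K-1, the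
  previous bound is d^(k-1) (d-(K-1)), which suffices for d at least K; for smaller d the left side
  is at most 0.\<close>

lemma card_lists_distinct_images_ge:
  fixes f :: "'a \<Rightarrow> 'b"
  assumes "finite D" "\<And>y. card {x\<in>D. f x = y} \<le> 2" and k: "k \<ge> 2"
    and K: "K = (real k)\<^sup>2 - real k + 1"
  shows "real (card D) ^ k / K - K ^ (k - 1)
           \<le> real (card {xs. length xs = k \<and> set xs \<subseteq> D \<and> distinct (map f xs)})"
proof -
  let ?d = "real (card D)"
  obtain j where j: "k = Suc j" using k by (cases k) auto
  have kk: "real k * (real k - 1) = K - 1" using K by (simp add: algebra_simps power2_eq_square)
  have K1: "K \<ge> 1" using square_minus_self_plus_one_ge[of k] K by linarith
  show ?thesis
  proof (cases "?d \<ge> K")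
    case True
    \<comment> \<open>Clearing the denominator in d/K <= d-(K-1) leaves exactly this
      product.\<close>
    have "0 \<le> (K - 1) * (?d - K)" using K1 True by simp
    then have "?d / K \<le> ?d - (K - 1)" using K1 by (simp add: field_simps)
    then have "?d ^ j * (?d / K) \<le> ?d ^ j * (?d - (K - 1))" by (intro mult_left_mono) auto
    then have "?d ^ k / K \<le> ?d ^ k - real k * (real k - 1) * ?d ^ (k - 1)"
      unfolding kk by (simp add: j algebra_simps)
    moreover have "0 \<le> K ^ (k - 1)" using K1 by simp
    ultimately show ?thesis
      using card_lists_distinct_images[OF assms(1,2), of k] by linarith
  next
    case False
    have "?d ^ k \<le> K ^ k" using False by (intro power_mono) auto
    then have "?d ^ k / K \<le> K ^ (k - 1)" using K1 by (simp add: j field_simps)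
    then show ?thesis by (smt (verit) of_nat_0_le_iff)
  qed
qed

lemma power_mean_sum:
  fixes x :: "'a \<Rightarrow> real"
  assumes "finite A" "A \<noteq> {}" "\<And>a. a \<in> A \<Longrightarrow> x a \<ge> 0" and pos: "sum x A > 0"
  shows "real (card A) * (sum x A / real (card A)) ^ k \<le> (\<Sum>a\<in>A. x a ^ k)"
proof -
  define \<mu> where "\<mu> = sum x A / real (card A)"
  have cA: "real (card A) > 0" using assms(1,2) by (simp add: card_gt_0_iff)
  have \<mu>: "\<mu> > 0" using pos cA by (simp add: \<mu>_def)
  \<comment> \<open>the tangent to \<open>x\<^sup>k\<close> at the mean lies below the graph\<close>
  have "\<mu> ^ k * (1 + real k * (x a / \<mu> - 1)) \<le> x a ^ k" if "a \<in> A" for a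
  proof -
    have "1 + real k * (x a / \<mu> - 1) \<le> (1 + (x a / \<mu> - 1)) ^ k"
      using assms(3)[OF that] \<mu> by (intro Bernoulli_inequality) simp
    then have "\<mu> ^ k * (1 + real k * (x a / \<mu> - 1)) \<le> \<mu> ^ k * (x a / \<mu>) ^ k"
      using \<mu> by (intro mult_left_mono) auto
    also have "\<dots> = x a ^ k" using \<mu> by (simp add: power_divide)
    finally show ?thesis .
  qed
  then have "(\<Sum>a\<in>A. \<mu> ^ k * (1 + real k * (x a / \<mu> - 1))) \<le> (\<Sum>a\<in>A. x a ^ k)"
    by (intro sum_mono)
  moreover have "(\<Sum>a\<in>A. \<mu> ^ k * (1 + real k * (x a / \<mu> - 1))) =
      \<mu> ^ k * (real (card A) + real k * (sum x A / \<mu> - real (card A)))"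
    by (simp add: sum_distrib_left[symmetric] sum.distrib sum_subtractf sum_divide_distrib)
  \<comment> \<open>The deviations from the mean sum to zero, so the linear terms cancel.\<close>
  moreover have "sum x A / \<mu> = real (card A)" using pos cA by (simp add: \<mu>_def)
  ultimately show ?thesis by (simp add: \<mu>_def mult.commute)
qed

text \<open>The constant in \<open>q\<close> comes from here. A factor 2 is the one in
  \<open>min_degree_subset\<close>, another 2 pays for replacing (n-1)^k by n^k, and
  \<open>K\<close> pays for the distinctness of the edges. In k(km+1) = k^2 m + k the first summand
  is the degree wanted and the second leaves room for the error term
  \<open>C * K ^ (k - 1)\<close>.\<close>

lemma colour_count_estimate:
  fixes C K :: real and n k m :: nat
  assumes k: "k \<ge> 2" and K: "K = (real k)\<^sup>2 - real k + 1"
    and C: "C > 0" "C \<le> (real n)\<^sup>2"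
    and Ck: "C ^ (k - 1) * (4 * real k * (real k * real m + 1) * K) \<le> real n ^ k"
    and n: "n \<ge> 2 * k" "real n \<ge> K ^ (k - 1)"
  shows "2 * (real k ^ 2 * real m) * real n ^ k
           < C * (real n * (real n - 1) / C) ^ k / K - C * K ^ (k - 1)"
proof -
  obtain j where j: "k = Suc j" using k by (cases k) auto
  have K1: "K \<ge> 1" using square_minus_self_plus_one_ge[of k] K by linarith
  have n0: "real n > 0" "real n \<ge> 2 * real k" using n(1) k by linarith+
  let ?M = "real k * real m + 1"
  have M: "?M > 0" by (simp add: add_nonneg_pos)
  \<comment> \<open>Bernoulli's inequality and n >= 2k give (1 - 1/n)^k >= 1 - k/n >= 1/2.\<close>
  have "1 + real k * (- (1 / real n)) \<le> (1 + - (1 / real n)) ^ k"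
    using n0 k by (intro Bernoulli_inequality) (auto simp: field_simps)
  moreover have "real k / real n \<le> 1 / 2" using n0 by (simp add: field_simps)
  ultimately have "1 / 2 \<le> (1 - 1 / real n) ^ k" by simp
  moreover have "1 - 1 / real n = (real n - 1) / real n"
    using n0 by (simp add: diff_divide_distrib)
  ultimately have "1 / 2 \<le> ((real n - 1) / real n) ^ k" by simp
  then have half: "real n ^ k / 2 \<le> (real n - 1) ^ k"
    using n0 by (simp add: power_divide field_simps)
  have KC: "K * C ^ j > 0" using K1 C by simp
  have "4 * real k * ?M * (real n - 1) ^ k * (K * C ^ j)
      = (C ^ (k - 1) * (4 * real k * ?M * K)) * (real n - 1) ^ k"
    by (simp add: j)
  also have "\<dots> \<le> real n ^ k * (real n - 1) ^ k"
    using n0 k by (intro mult_right_mono Ck) simp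
  finally have "4 * real k * ?M * (real n - 1) ^ k
      \<le> (real n * (real n - 1)) ^ k / (K * C ^ j)"
    using KC by (simp add: pos_le_divide_eq power_mult_distrib)
  also have "\<dots> = C * (real n * (real n - 1) / C) ^ k / K"
    using C by (simp add: power_divide j)
  finally have A: "4 * real k * ?M * (real n - 1) ^ k \<le> C * (real n * (real n - 1) / C) ^ k / K" .
  have "4 * real k * ?M * (real n ^ k / 2) \<le> 4 * real k * ?M * (real n - 1) ^ k"
    using M by (intro mult_left_mono half) auto
  with A have B: "2 * (real k ^ 2 * real m) * real n ^ k + 2 * real k * real n ^ k
      \<le> C * (real n * (real n - 1) / C) ^ k / K"
    by (simp add: algebra_simps power2_eq_square)
  have "C * K ^ (k - 1) \<le> (real n)\<^sup>2 * K ^ (k - 1)"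
    using C K1 by (intro mult_right_mono) auto
  also have "\<dots> < 2 * real k * real n ^ k"
  \<comment> \<open>For k >= 3 the bound K^(k-1) <= n costs one more factor n, which n^k can afford.
    For k = 2 it cannot, but there K = 3 is less than 2k = 4.\<close>
  proof (cases "k = 2")
    case True
    then have "K = 3" using K by simp
    then show ?thesis using True n0 by simp
  next
    case False
    then have "(real n)\<^sup>2 * K ^ (k - 1) \<le> (real n)\<^sup>2 * real n"
      using n(2) by (intro mult_left_mono) auto
    also have "\<dots> = real n ^ 3" by (simp add: power2_eq_square power3_eq_cube)
    also have "\<dots> \<le> real n ^ k"
      using False k n0 n(1) by (intro power_increasing) auto
    also have "\<dots> < 2 * real k * real n ^ k" using n0 k by simp
    finally show ?thesis .
  qed
  finally show ?thesis using B by linarith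
qed

section \<open>The auxiliary graph on tuples\<close>

text \<open>Distinctness is demanded of the k edges, not of the entries: this is what the counting
  of lists delivers, and for a proper colouring it makes the entries distinct as well.\<close>

definition tuple_adj :: "nat \<Rightarrow> (nat set \<Rightarrow> nat) \<Rightarrow> nat \<Rightarrow> (nat list \<times> nat list) set" where
  "tuple_adj n c k =
     {(v, w). length v = k \<and> length w = k \<and> set v \<subseteq> {..<n} \<and> set w \<subseteq> {..<n} \<and>
        distinct (map (\<lambda>(x, y). {x, y}) (zip v w)) \<and>
        (\<exists>a. \<forall>i<k. v ! i \<noteq> w ! i \<and> c {v ! i, w ! i} = a)}"

lemma edges_complete_graph: "{x, y} \<in> edges (complete_graph n) \<longleftrightarrow> x < n \<and> y < n \<and> x \<noteq> y"
  by (auto simp: complete_graph_def nsets_def card_2_iff doubleton_eq_iff card_insert_if)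

lemma proper_colouring_eqD:
  assumes "proper_colouring (complete_graph n) c" "c {x, y} = c {x, z}"
    and "x < n" "y < n" "z < n" "x \<noteq> y" "x \<noteq> z"
  shows "y = z"
proof (rule ccontr)
  assume "y \<noteq> z"
  then have "{x, y} \<noteq> {x, z}" by (auto simp: doubleton_eq_iff)
  with assms show False
    unfolding proper_colouring_def by (metis disjoint_iff edges_complete_graph insertI1)
qed

lemma sym_tuple_adj: "sym (tuple_adj n c k)"
proof (rule symI)
  fix v w assume vw: "(v, w) \<in> tuple_adj n c k"
  have "map (\<lambda>(x, y). {x, y}) (zip w v) = map (\<lambda>(x, y). {x, y}) (zip v w)"
    using vw by (intro nth_equalityI) (auto simp: tuple_adj_def)
  moreover obtain a where "\<forall>i<k. v ! i \<noteq> w ! i \<and> c {v ! i, w ! i} = a"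
    using vw unfolding tuple_adj_def by blast
  then have "\<forall>i<k. w ! i \<noteq> v ! i \<and> c {w ! i, v ! i} = a"
    by (metis insert_commute)
  ultimately show "(w, v) \<in> tuple_adj n c k"
    using vw unfolding tuple_adj_def by simp
qed

text \<open>If two entries of \<open>v\<close> agreed, two edges of the same colour would leave one
  vertex; properness would make them the same edge, against the distinctness of the edges.\<close>

lemma distinct_tuple_adj:
  assumes c: "proper_colouring (complete_graph n) c" and vw: "(v, w) \<in> tuple_adj n c k"
  shows "distinct v"
proof -
  have len: "length v = k" "length w = k" and sub: "set v \<subseteq> {..<n}" "set w \<subseteq> {..<n}"
    using vw unfolding tuple_adj_def by auto
  have lt: "v ! i < n" "w ! i < n" if "i < k" for i
    using that len sub nth_mem by (metis lessThan_iff subsetD)+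
  have dist: "distinct (map (\<lambda>(x, y). {x, y}) (zip v w))"
    using vw unfolding tuple_adj_def by auto
  obtain a where a: "\<And>i. i < k \<Longrightarrow> v ! i \<noteq> w ! i \<and> c {v ! i, w ! i} = a"
    using vw unfolding tuple_adj_def by auto
  have "v ! i \<noteq> v ! j" if ij: "i < k" "j < k" "i \<noteq> j" for i j
  proof
    assume eq: "v ! i = v ! j"
    have "w ! i = w ! j"
      using proper_colouring_eqD[OF c, of "v ! i" "w ! i" "w ! j"] a[OF ij(1)] a[OF ij(2)]
        lt ij eq by simp
    then show False
      using nth_eq_iff_index_eq[OF dist, of i j] ij len eq by simp
  qed
  then show ?thesis using len by (simp add: distinct_conv_nth)
qed

text \<open>A neighbour is determined by a position and its entry there: that entry fixes the common
  colour, and properness then fixes every other entry. There are k positions and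
  \<open>card B\<close> entries to choose from.\<close>

lemma card_tuple_neighbours_meeting:
  assumes c: "proper_colouring (complete_graph n) c" and B: "finite B"
  shows "card {w. (v, w) \<in> tuple_adj n c k \<and> set w \<inter> B \<noteq> {}} \<le> k * card B"
proof -
  let ?W = "{w. (v, w) \<in> tuple_adj n c k \<and> set w \<inter> B \<noteq> {}}"
  define ix where "ix = (\<lambda>w. SOME i. i < k \<and> w ! i \<in> B)"
  have ix: "ix w < k \<and> w ! ix w \<in> B" if "w \<in> ?W" for w
  proof -
    have "\<exists>i. i < k \<and> w ! i \<in> B"
      using that by (auto simp: tuple_adj_def in_set_conv_nth)
    then show ?thesis unfolding ix_def by (rule someI_ex)
  qed
  have "inj_on (\<lambda>w. (ix w, w ! ix w)) ?W"
  proof (rule inj_onI)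
    fix w w' assume w: "w \<in> ?W" and w': "w' \<in> ?W"
      and eq: "(ix w, w ! ix w) = (ix w', w' ! ix w')"
    obtain a where a: "\<And>i. i < k \<Longrightarrow> v ! i \<noteq> w ! i \<and> c {v ! i, w ! i} = a"
      using w unfolding tuple_adj_def by auto
    obtain a' where a': "\<And>i. i < k \<Longrightarrow> v ! i \<noteq> w' ! i \<and> c {v ! i, w' ! i} = a'"
      using w' unfolding tuple_adj_def by auto
    have len: "length v = k" "length w = k" "length w' = k"
      and sub: "set v \<subseteq> {..<n}" "set w \<subseteq> {..<n}" "set w' \<subseteq> {..<n}"
      using w w' unfolding tuple_adj_def by auto
    have lt: "v ! i < n" "w ! i < n" "w' ! i < n" if "i < k" for i
      using that len sub nth_mem by (metis lessThan_iff subsetD)+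
    have "a = a'" using a[of "ix w"] a'[of "ix w"] eq ix[OF w]
      by (metis Pair_inject)
    then have "w ! i = w' ! i" if "i < k" for i
      using proper_colouring_eqD[OF c, of "v ! i" "w ! i" "w' ! i"] a[OF that] a'[OF that]
        lt[OF that] by simp
    then show "w = w'" using len by (intro nth_equalityI) auto
  qed
  moreover have "(\<lambda>w. (ix w, w ! ix w)) ` ?W \<subseteq> {..<k} \<times> B" using ix by auto
  ultimately have "card ?W \<le> card ({..<k} \<times> B)"
    using B by (intro card_inj_on_le) auto
  then show ?thesis by (simp add: card_cartesian_product)
qed

text \<open>Unzipping turns a list of k ordered pairs of one colour, with distinct underlying edges,
  into an adjacent pair of tuples. The colour classes \<open>D a\<close> have n(n-1) ordered pairs
  in total, so the list count for each class and the power mean inequality over all \<open>C\<close>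
  classes give the bound. The other two conclusions feed
  \<open>colour_count_estimate\<close>.\<close>

lemma card_tuple_adj_ge:
  assumes k: "k \<ge> 2" and K: "K = (real k)\<^sup>2 - real k + 1" and n: "n \<ge> 2"
    and C: "C = real (card (c ` edges (complete_graph n)))"
  shows "C * (real n * (real n - 1) / C) ^ k / K - C * K ^ (k - 1) \<le> real (card (tuple_adj n c k))"
    and "0 < C" and "C \<le> (real n)\<^sup>2"
proof -
  define A where "A = c ` edges (complete_graph n)"
  define D where "D = (\<lambda>a. {(x, y). x < n \<and> y < n \<and> x \<noteq> y \<and> c {x, y} = a})"
  define e where "e = (\<lambda>p::nat \<times> nat. case p of (x, y) \<Rightarrow> {x, y})"
  define L where "L = (\<lambda>a. {ps. length ps = k \<and> set ps \<subseteq> D a \<and> distinct (map e ps)})"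
  define Z where "Z = {..<n} \<times> {..<n} - (\<lambda>x. (x, x)) ` {..<n}"
  have cZ: "card Z = n * n - n"
    unfolding Z_def by (subst card_Diff_subset) (auto simp: card_image inj_on_def)
  have finZ: "finite Z" unfolding Z_def by simp
  have "edges (complete_graph n) = (\<lambda>(x, y). {x, y}) ` Z"
  proof (intro subset_antisym subsetI)
    fix e assume "e \<in> edges (complete_graph n)"
    then obtain x y where "e = {x, y}" "(x, y) \<in> Z"
      by (auto simp: complete_graph_def nsets_def Z_def card_2_iff)
    then show "e \<in> (\<lambda>(x, y). {x, y}) ` Z" by force
  next
    fix e assume "e \<in> (\<lambda>(x, y). {x, y}) ` Z"
    then show "e \<in> edges (complete_graph n)" by (auto simp: Z_def edges_complete_graph)
  qed
  then have A: "A = (\<lambda>(x, y). c {x, y}) ` Z"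
    by (simp add: A_def image_image split_beta)
  have finA: "finite A" unfolding A using finZ by simp
  have "(0, 1) \<in> Z" using n by (auto simp: Z_def)
  then have neA: "A \<noteq> {}" unfolding A by blast
  have CA: "C = real (card A)" by (simp add: C A_def)
  show "0 < C" using CA finA neA by (simp add: card_gt_0_iff)
  have "card A \<le> n * n" unfolding A using card_image_le[OF finZ] cZ by (metis diff_le_self le_trans)
  then show "C \<le> (real n)\<^sup>2" unfolding CA power2_eq_square by (metis of_nat_le_iff of_nat_mult)
  have finD: "finite (D a)" for a
    by (rule finite_subset[of _ "{..<n} \<times> {..<n}"]) (auto simp: D_def)
  have UD: "(\<Union>a\<in>A. D a) = Z"
    unfolding A by (auto simp: D_def Z_def)
  have "card (\<Union>a\<in>A. D a) = (\<Sum>a\<in>A. card (D a))"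
    using finA finD by (intro card_UN_disjoint) (auto simp: D_def)
  then have sumD: "(\<Sum>a\<in>A. real (card (D a))) = real n * (real n - 1)"
    unfolding UD cZ of_nat_sum[symmetric] using n
    by (metis le_square of_nat_diff of_nat_mult mult.right_neutral right_diff_distrib)
  have fib: "card {p\<in>D a. e p = y} \<le> 2" for a y
  proof (cases "{p\<in>D a. e p = y} = {}")
    case False
    then obtain u v where uv: "y = {u, v}" by (auto simp: e_def)
    have "p \<in> set [(u, v), (v, u)]" if "e p = y" for p
      using that unfolding uv e_def by (cases p) (auto simp: doubleton_eq_iff)
    then have "{p\<in>D a. e p = y} \<subseteq> set [(u, v), (v, u)]" by blast
    then have "card {p\<in>D a. e p = y} \<le> card (set [(u, v), (v, u)])"
      by (intro card_mono finite_set)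
    also have "\<dots> \<le> length [(u, v), (v, u)]" by (rule card_length)
    finally show ?thesis by simp
  next
    case True
    then show ?thesis by (metis card.empty zero_le)
  qed
  have "C * (real n * (real n - 1) / C) ^ k \<le> (\<Sum>a\<in>A. real (card (D a)) ^ k)"
    using power_mean_sum[OF finA neA, of "\<lambda>a. real (card (D a))" k] n sumD CA by simp
  moreover have "K > 0" using square_minus_self_plus_one_ge[of k] K by linarith
  ultimately have "C * (real n * (real n - 1) / C) ^ k / K - C * K ^ (k - 1)
      \<le> (\<Sum>a\<in>A. real (card (D a)) ^ k) / K - C * K ^ (k - 1)"
    by (intro diff_right_mono divide_right_mono) auto
  also have "\<dots> = (\<Sum>a\<in>A. real (card (D a)) ^ k / K - K ^ (k - 1))"
    by (simp add: sum_subtractf CA sum_divide_distrib)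
  also have "\<dots> \<le> (\<Sum>a\<in>A. real (card (L a)))"
    unfolding L_def using card_lists_distinct_images_ge[OF finD fib k K] by (intro sum_mono)
  also have "\<dots> = real (card (\<Union>a\<in>A. L a))"
  proof -
    have "finite (L a)" for a
      by (rule finite_subset[OF _ finite_lists_length_eq[OF finD[of a], of k]]) (auto simp: L_def)
    moreover have "L a \<inter> L b = {}" if "a \<noteq> b" for a b
    proof (rule ccontr)
      assume "L a \<inter> L b \<noteq> {}"
      then obtain ps where ps: "ps \<in> L a" "ps \<in> L b" by blast
      \<comment> \<open>As k is positive, the list has a head, whose colour would be both
        \<open>a\<close> and \<open>b\<close>.\<close>
      then have "ps \<noteq> []" using k by (auto simp: L_def)
      then have "hd ps \<in> set ps" by simp
      then have "hd ps \<in> D a" "hd ps \<in> D b" using ps by (auto simp: L_def)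
      with that show False by (auto simp: D_def)
    qed
    ultimately show ?thesis using finA by (subst card_UN_disjoint) auto
  qed
  also have "\<dots> \<le> real (card (tuple_adj n c k))"
  proof -
    let ?h = "\<lambda>ps. (map fst ps, map snd ps)"
    \<comment> \<open>Zipping the two components recovers the list.\<close>
    have "inj ?h" by (rule injI) (metis Pair_inject zip_map_fst_snd)
    then have "inj_on ?h (\<Union>a\<in>A. L a)" using inj_on_subset by blast
    moreover have "?h ps \<in> tuple_adj n c k" if ps: "ps \<in> L a" for ps a
    proof -
      have len: "length ps = k" and sub: "set ps \<subseteq> D a" and dist: "distinct (map e ps)"
        using ps by (auto simp: L_def)
      have "ps ! i \<in> D a" if "i < k" for i using that len sub nth_mem by blast
      then have "\<forall>i<k. fst (ps ! i) \<noteq> snd (ps ! i) \<and> c {fst (ps ! i), snd (ps ! i)} = a"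
        by (force simp: D_def)
      moreover have "fst ` set ps \<subseteq> {..<n}" "snd ` set ps \<subseteq> {..<n}"
        using sub by (force simp: D_def)+
      ultimately show ?thesis
        using len dist unfolding tuple_adj_def e_def by (simp add: zip_map_fst_snd)
    qed
    then have "?h ` (\<Union>a\<in>A. L a) \<subseteq> tuple_adj n c k" by blast
    moreover have "finite (tuple_adj n c k)"
    proof (rule finite_subset)
      show "tuple_adj n c k \<subseteq> {v. set v \<subseteq> {..<n} \<and> length v = k} \<times> {v. set v \<subseteq> {..<n} \<and> length v = k}"
        by (auto simp: tuple_adj_def)
    qed (simp add: finite_lists_length_eq)
    ultimately show ?thesis by (simp add: card_inj_on_le)
  qed
  finally show "C * (real n * (real n - 1) / C) ^ k / K - C * K ^ (k - 1)
      \<le> real (card (tuple_adj n c k))" .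
qed

section \<open>From an embedded tree to a repeat\<close>

definition map_graph :: "('a \<Rightarrow> 'b) \<Rightarrow> 'a ugraph \<Rightarrow> 'b ugraph" where
  "map_graph f G = \<lparr>verts = f ` verts G, edges = (`) f ` edges G\<rparr>"

lemma graph_iso_map_graph:
  assumes "simple_graph G" "inj_on f (verts G)"
  shows "graph_iso f G (map_graph f G)"
proof -
  have sub: "e \<subseteq> verts G" if "e \<in> edges G" for e
    using assms(1) that by (auto simp: simple_graph_def nsets_def)
  have "{u, v} \<in> edges G" if "u \<in> verts G" "v \<in> verts G" "e \<in> edges G" "{f u, f v} = f ` e" for u v e
  proof -
    have "f ` {u, v} = f ` e" using that by simp
    moreover have "{u, v} \<subseteq> verts G" "e \<subseteq> verts G" using that sub by auto
    ultimately have "{u, v} = e" using inj_on_image_eq_iff[OF assms(2)] by meson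
    then show ?thesis using that by simp
  qed
  moreover have "{f u, f v} \<in> (`) f ` edges G" if "{u, v} \<in> edges G" for u v
    using that by (metis image_empty image_eqI image_insert)
  ultimately show ?thesis
    using assms(2) unfolding graph_iso_def map_graph_def by (auto simp: bij_betw_def)
qed

lemma simple_graph_map_graph:
  assumes "simple_graph G" "inj_on f (verts G)"
  shows "simple_graph (map_graph f G)"
proof -
  have "f ` e \<in> nsets (f ` verts G) 2" if "e \<in> edges G" for e
  proof -
    have "e \<subseteq> verts G" "finite e" "card e = 2"
      using assms(1) that by (auto simp: simple_graph_def nsets_def)
    moreover then have "card (f ` e) = 2"
      using assms(2) by (metis card_image inj_on_subset)
    ultimately show ?thesis by (auto simp: nsets_def)
  qed
  then show ?thesis using assms(1) by (auto simp: simple_graph_def map_graph_def)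
qed

text \<open>Both images are parametrised by \<open>G\<close>: going back along \<open>f\<close> and
  forward along \<open>g\<close> is the isomorphism.\<close>

lemma colour_isomorphic_map_graph:
  assumes G: "simple_graph G" and f: "inj_on f (verts G)" and g: "inj_on g (verts G)"
    and c: "\<And>e. e \<in> edges G \<Longrightarrow> c (f ` e) = c (g ` e)"
  shows "colour_isomorphic c (map_graph f G) (map_graph g G)"
proof -
  define h where "h = g \<circ> inv_into (verts G) f"
  have h: "h (f x) = g x" if "x \<in> verts G" for x using that f by (simp add: h_def)
  have F: "graph_iso f G (map_graph f G)" and F': "graph_iso g G (map_graph g G)"
    using graph_iso_map_graph G f g by blast+
  have "bij_betw h (f ` verts G) (g ` verts G)"
    unfolding h_def using f g
    by (meson bij_betw_imageI bij_betw_inv_into bij_betw_trans)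
  then have "graph_iso h (map_graph f G) (map_graph g G)"
    using F F' h unfolding graph_iso_def by (auto simp: map_graph_def)
  moreover have "c (h ` e') = c e'" if "e' \<in> edges (map_graph f G)" for e'
  proof -
    obtain e where e: "e \<in> edges G" "e' = f ` e"
      using \<open>e' \<in> edges (map_graph f G)\<close> unfolding map_graph_def by (auto simp: image_iff)
    have "e \<subseteq> verts G" using G e(1) by (auto simp: simple_graph_def nsets_def)
    then have "h ` f ` e = g ` e" using h by (force simp: image_image)
    then show ?thesis using c e by simp
  qed
  ultimately show ?thesis unfolding colour_isomorphic_def by blast
qed

text \<open>The k copies are the coordinate projections of the embedding. Entries are distinct
  within a tuple and tuples are disjoint, so position and tree vertex can be read off from an entry;
  this makes each projection injective and different projections disjoint. Adjacency of tuples gives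
  an edge of \<open>T\<close> the same colour in every coordinate.\<close>

lemma is_repeat_of_tuple_embedding:
  assumes c: "proper_colouring (complete_graph n) c" and T: "tree T"
    and adj: "\<And>s t. {s, t} \<in> edges T \<Longrightarrow> (\<phi> s, \<phi> t) \<in> tuple_adj n c k"
    and len: "\<And>t. t \<in> verts T \<Longrightarrow> length (\<phi> t) = k \<and> set (\<phi> t) \<subseteq> {..<n} \<and> distinct (\<phi> t)"
    and disj: "\<And>s t. s \<in> verts T \<Longrightarrow> t \<in> verts T \<Longrightarrow> s \<noteq> t \<Longrightarrow> set (\<phi> s) \<inter> set (\<phi> t) = {}"
  shows "\<exists>S. is_repeat (complete_graph n) c k T S"
proof -
  have G: "simple_graph T" and ne: "verts T \<noteq> {}"
    using T by (auto simp: tree_def connected_graph_def)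
  define f where "f = (\<lambda>i t. \<phi> t ! i)"
  define F where "F = (\<lambda>i. map_graph (f i) T)"
  have eq: "s = t \<and> i = j"
    if "s \<in> verts T" "t \<in> verts T" "i < k" "j < k" "f i s = f j t" for s t i j
  proof -
    have "f i s \<in> set (\<phi> s)" "f j t \<in> set (\<phi> t)" using that(1-4) len nth_mem by (simp_all add: f_def)
    then have "s = t" using disj that by (metis disjoint_iff)
    moreover have "i = j"
      using that \<open>s = t\<close> len[of t] by (simp add: f_def nth_eq_iff_index_eq)
    ultimately show ?thesis by simp
  qed
  have inj: "inj_on (f i) (verts T)" if "i < k" for i
    using eq that by (intro inj_onI) blast
  have fn: "f i t < n" if "i < k" "t \<in> verts T" for i t
    using len[OF that(2)] that(1) by (metis f_def lessThan_iff nth_mem subsetD)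
  have edge: "\<exists>s t. e = {s, t} \<and> s \<in> verts T \<and> t \<in> verts T \<and> s \<noteq> t" if "e \<in> edges T" for e
    using G that by (fastforce simp: simple_graph_def nsets_def card_2_iff)
  have dF: "disjnt (verts (F i)) (verts (F j))" if "i < k" "j < k" "i \<noteq> j" for i j
    using eq that by (fastforce simp: F_def map_graph_def disjnt_iff)
  \<comment> \<open>A repeat is a set of graphs, so the k projections must be different graphs;
    being disjoint suffices because \<open>T\<close> has a vertex.\<close>
  have "inj_on F {..<k}"
  proof (rule inj_onI, rule ccontr)
    fix i j assume "i \<in> {..<k}" "j \<in> {..<k}" "F i = F j" "i \<noteq> j"
    then have "disjnt (verts (F i)) (verts (F i))" using dF by (metis lessThan_iff)
    then show False using ne by (simp add: F_def map_graph_def disjnt_def)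
  qed
  then have "card (F ` {..<k}) = k" by (simp add: card_image)
  moreover have "copy_in (complete_graph n) T (F i)" if i: "i < k" for i
  proof -
    have "f i ` e \<in> edges (complete_graph n)" if "e \<in> edges T" for e
    proof -
      obtain s t where st: "e = {s, t}" "s \<in> verts T" "t \<in> verts T" "s \<noteq> t"
        using edge \<open>e \<in> edges T\<close> by blast
      then have "f i s \<noteq> f i t" using eq i by blast
      then show ?thesis using st fn i by (simp add: edges_complete_graph)
    qed
    then have "edges (F i) \<subseteq> edges (complete_graph n)" by (auto simp: F_def map_graph_def)
    moreover have "verts (F i) \<subseteq> verts (complete_graph n)"
      using fn i by (auto simp: F_def map_graph_def complete_graph_def)
    ultimately show ?thesis
      unfolding copy_in_def F_def
      using simple_graph_map_graph graph_iso_map_graph G inj[OF i] by blast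
  qed
  moreover have "colour_isomorphic c (F i) (F j)" if ij: "i < k" "j < k" for i j
    unfolding F_def
  proof (rule colour_isomorphic_map_graph[OF G inj inj])
    fix e assume e: "e \<in> edges T"
    then obtain s t where st: "e = {s, t}" using edge by blast
    then have "(\<phi> s, \<phi> t) \<in> tuple_adj n c k" using adj e by simp
    then have "\<exists>a. \<forall>i<k. \<phi> s ! i \<noteq> \<phi> t ! i \<and> c {\<phi> s ! i, \<phi> t ! i} = a"
      unfolding tuple_adj_def by blast
    then show "c (f i ` e) = c (f j ` e)" using ij by (auto simp: st f_def)
  qed (use ij in auto)
  moreover have "pairwise (\<lambda>F F'. disjnt (verts F) (verts F')) (F ` {..<k})"
    using dF by (auto simp: pairwise_def)
  ultimately have "is_repeat (complete_graph n) c k T (F ` {..<k})"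
    unfolding is_repeat_def by (auto simp: pairwise_def)
  then show ?thesis by blast
qed

section \<open>Conclusion\<close>

text \<open>The lower bound on \<open>tuple_adj\<close> is where the small number of colours enters.
  The tuples used so far number at most m and have at most km entries, so at most k^2 m neighbours
  of a tuple meet them, fewer than its degree in \<open>U\<close>.\<close>

lemma few_colours_imp_repeat:
  fixes T :: "'a ugraph"
  assumes T: "tree T" and c: "proper_colouring (complete_graph n) c" and k: "k \<ge> 2"
    and m: "card (edges T) = m"
    and card: "2 * (k\<^sup>2 * m) * n ^ k < card (tuple_adj n c k)"
  shows "\<exists>S. is_repeat (complete_graph n) c k T S"
proof -
  let ?V = "{v. set v \<subseteq> {..<n} \<and> length v = k}" and ?R = "tuple_adj n c k"
  have "finite ?V" by (simp add: finite_lists_length_eq)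
  moreover have "card ?V = n ^ k" by (simp add: card_lists_length_eq)
  moreover have "?R \<subseteq> ?V \<times> ?V" by (auto simp: tuple_adj_def)
  ultimately obtain U where U: "U \<subseteq> ?V" "U \<noteq> {}" "\<forall>u\<in>U. card {w\<in>U. (u, w) \<in> ?R} > k\<^sup>2 * m"
    using min_degree_subset[of ?V ?R "k\<^sup>2 * m"] card sym_tuple_adj by auto
  have finU: "finite U" using U(1) \<open>finite ?V\<close> finite_subset by blast
  \<comment> \<open>A tuple without neighbours may repeat entries, so distinctness is drawn from the
    positive degree in \<open>U\<close>. This also serves the one-vertex tree, whose embedding has
    no edges.\<close>
  have distU: "distinct u" if "u \<in> U" for u
  proof -
    have "card {w\<in>U. (u, w) \<in> ?R} > 0" using U(3) that by fastforce
    then obtain w where "(u, w) \<in> ?R" by (auto simp: card_gt_0_iff)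
    then show ?thesis by (rule distinct_tuple_adj[OF c])
  qed
  obtain u0 where "u0 \<in> U" using U(2) by blast
  have "\<exists>w\<in>U. (v, w) \<in> ?R \<and> (\<forall>a\<in>A. set a \<inter> set w = {})"
    if v: "v \<in> U" and A: "A \<subseteq> U" "finite A" "card A \<le> card (edges T)" for v A
  proof -
    define B where "B = (\<Union>a\<in>A. set a)"
    have finB: "finite B" using A(2) by (simp add: B_def)
    have "card B \<le> (\<Sum>a\<in>A. card (set a))" unfolding B_def by (rule card_UN_le[OF A(2)])
    also have "\<dots> \<le> (\<Sum>a\<in>A. k)"
    proof (rule sum_mono)
      fix a assume "a \<in> A"
      then have "length a = k" using A(1) U(1) by blast
      then show "card (set a) \<le> k" using card_length by blast
    qed
    also have "\<dots> \<le> k * m" using A(3) m by simp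
    finally have "k * card B \<le> k * (k * m)" by (intro mult_left_mono) auto
    then have "card {w. (v, w) \<in> ?R \<and> set w \<inter> B \<noteq> {}} \<le> k\<^sup>2 * m"
      using card_tuple_neighbours_meeting[OF c finB, of v k]
      by (simp only: power2_eq_square mult.assoc le_trans)
    moreover have "finite {w. (v, w) \<in> ?R \<and> set w \<inter> B \<noteq> {}}"
      by (rule finite_subset[OF _ \<open>finite ?V\<close>]) (auto simp: tuple_adj_def)
    ultimately have "\<not> {w\<in>U. (v, w) \<in> ?R} \<subseteq> {w. (v, w) \<in> ?R \<and> set w \<inter> B \<noteq> {}}"
      using U(3) v card_mono by (meson leD le_trans)
    then show ?thesis unfolding B_def by blast
  qed
  then obtain \<phi> where \<phi>: "\<phi> ` verts T \<subseteq> U" "\<forall>s t. {s, t} \<in> edges T \<longrightarrow> (\<phi> s, \<phi> t) \<in> ?R"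
      "\<forall>s\<in>verts T. \<forall>t\<in>verts T. s \<noteq> t \<longrightarrow> set (\<phi> s) \<inter> set (\<phi> t) = {}"
    using greedy_tree_embedding[OF T sym_tuple_adj, of "\<lambda>a w. set a \<inter> set w = {}" u0 U n c k]
      \<open>u0 \<in> U\<close> by (auto simp: symp_def Int_commute)
  show ?thesis
  proof (rule is_repeat_of_tuple_embedding[OF c T])
    show "length (\<phi> t) = k \<and> set (\<phi> t) \<subseteq> {..<n} \<and> distinct (\<phi> t)" if "t \<in> verts T" for t
      using that \<phi>(1) U(1) distU by blast
    show "(\<phi> s, \<phi> t) \<in> ?R" if "{s, t} \<in> edges T" for s t
      using \<phi>(2) that by simp
    show "set (\<phi> s) \<inter> set (\<phi> t) = {}" if "s \<in> verts T" "t \<in> verts T" "s \<noteq> t" for s t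
      using \<phi>(3) that by simp
  qed
qed

theorem theorem3p2:
  fixes T :: "'a ugraph" and m k :: nat and q :: real
  assumes "tree T" and "card (edges T) = m" and "k \<ge> 2"
    and "q = (4 * real k * (real k * real m + 1) * ((real k)\<^sup>2 - real k + 1))
               powr (1 / (real k - 1))"
  shows "\<forall>\<^sub>F n in sequentially.
           ereal_of_enat (repeat_number k n T) \<ge> ereal (real n powr (real k / (real k - 1)) / q)"
proof -
  define K where "K = (real k)\<^sup>2 - real k + 1"
  define Q where "Q = 4 * real k * (real k * real m + 1) * K"
  have k1: "real k - 1 > 0" using assms(3) by simp
  have "K > 0" using square_minus_self_plus_one_ge[of k] unfolding K_def by linarith
  have Qpos: "Q > 0" unfolding Q_def using \<open>K > 0\<close> k1 by (simp add: add_nonneg_pos)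
  have q: "q = Q powr (1 / (real k - 1))" using assms(4) by (simp add: Q_def K_def)
  have qpos: "q > 0" using q Qpos by simp
  \<comment> \<open>Bounding every admissible number of colours bounds their minimum; the two
    thresholds on \<open>n\<close> are those of \<open>colour_count_estimate\<close>.\<close>
  have bound: "real n powr (real k / (real k - 1)) / q \<le> real C"
    if n: "n \<ge> 2 * k" "real n \<ge> K ^ (k - 1)" and C: "C \<in> repeat_free_colour_counts k n T" for n C
  proof (rule ccontr)
    assume "\<not> ?thesis"
    then have less: "real C < real n powr (real k / (real k - 1)) / q" by simp
    obtain c :: "nat set \<Rightarrow> nat" where c: "proper_colouring (complete_graph n) c"
        "card (c ` edges (complete_graph n)) = C" "\<nexists>S. is_repeat (complete_graph n) c k T S"
      using C unfolding repeat_free_colour_counts_def by auto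
    have n2: "n \<ge> 2" using n(1) assms(3) by linarith
    note adj = card_tuple_adj_ge[OF assms(3) K_def n2, of "real C" c, unfolded c(2), OF refl]
    \<comment> \<open>Raising to the power k-1 removes both roots: q^(k-1) = Q, and n^(k/(k-1))
      becomes n^k.\<close>
    have "real C ^ (k - 1) = real C powr (real k - 1)"
      using adj(2) assms(3) by (simp add: powr_realpow[symmetric] of_nat_diff)
    also have "\<dots> \<le> (real n powr (real k / (real k - 1)) / q) powr (real k - 1)"
      using less k1 by (intro powr_mono2) auto
    also have "\<dots> = real n ^ k / Q"
      using k1 n2 Qpos q by (simp add: powr_divide powr_powr powr_realpow)
    finally have "real C ^ (k - 1) * Q \<le> real n ^ k" using Qpos by (simp add: pos_le_divide_eq)
    then have "2 * (real k ^ 2 * real m) * real n ^ k < real (card (tuple_adj n c k))"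
      using colour_count_estimate[OF assms(3) K_def adj(2,3) _ n] adj(1) unfolding Q_def
      by fastforce
    then have "real (2 * (k\<^sup>2 * m) * n ^ k) < real (card (tuple_adj n c k))" by simp
    then have "2 * (k\<^sup>2 * m) * n ^ k < card (tuple_adj n c k)" by (simp only: of_nat_less_iff)
    then show False
      using few_colours_imp_repeat[OF assms(1) c(1) assms(3,2)] c(3) by blast
  qed
  have "\<forall>\<^sub>F n in sequentially. n \<ge> 2 * k \<and> real n \<ge> K ^ (k - 1)"
    by (intro eventually_conj eventually_ge_at_top
        filterlim_real_sequentially[unfolded filterlim_at_top, rule_format])
  then show ?thesis
  proof eventually_elim
    case (elim n)
    let ?x = "real n powr (real k / (real k - 1)) / q"
    show ?case
    proof (cases "repeat_free_colour_counts k n T = {}")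
      \<comment> \<open>With no admissible colouring the minimum is infinity and the bound is
        trivial; an edgeless \<open>T\<close> leads here.\<close>
      case True
      then show ?thesis by (simp add: repeat_number_def top_enat_def)
    next
      case False
      then have "(LEAST C. C \<in> repeat_free_colour_counts k n T) \<in> repeat_free_colour_counts k n T"
        using LeastI_ex[of "\<lambda>C. C \<in> repeat_free_colour_counts k n T"] by blast
      then show ?thesis
        using bound elim by (simp add: repeat_number_eq_Least[OF False])
    qed
  qed
qed

end
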